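(* Let $(\mathcal{C},\otimes,I)$ be a gs-monoidal category with dischargers $!_X\colon X\to I$. Then $\mathcal{C}$ has projections (i.e. the family $!_X\colon X\to I$ is natural in $X$) if and only if $\mathcal{C}$ is a Markov category. In other words, gs-monoidal categories with projections correspond exactly to Markov categories.
   Context: Coherence isomorphisms of the monoidal structure are suppressed; $\gamma$ denotes the braiding. A gs-monoidal category is a symmetric monoidal category $(\mathcal{C},\otimes,I)$ together with, for every object $X$, arrows $\nabla_X\colon X\to X\otimes X$ (duplicator) and $!_X\colon X\to I$ (discharger) making $X$ a commutative comonoid (coassociative, cocommutative, counital) and multiplicative with respect to the monoidal structure: $\nabla_{X\otimes Y}=(\mathrm{id}_X\otimes\gamma_{X,Y}\otimes\mathrm{id}_Y)\circ(\nabla_X\otimes\nabla_Y)$, $\nabla_I=\mathrm{id}_I$, $!_{X\otimes Y}=\,!_X\otimes !_Y$, $!_I=\mathrm{id}_I$. No naturality of $\nabla$ or $!$ is required. A gs-monoidal category has projections if $!$ is a natural transformation, i.e. $!_Y\circ f=\,!_X$ for every arrow $f\colon X\to Y$. A Markov category is a gs-monoidal category such that for each object $X$ and each arrow $f\colon X\to I$ one has $f=\,!_X$. *)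

theory Defs
  imports Main
begin

text \<open>
  Categories are given by a set of objects and a set of arrows. All operations are total HOL
  functions, and the axioms constrain them only on objects and on composable arrows.
  The monoidal structure is not assumed to be strict: coherence isomorphisms
  are explicit data and are written out wherever informal notation suppresses them.
\<close>

record ('o, 'a) cat_data =
  Obj :: "'o set"
  Arr :: "'a set"
  Dom :: "'a \<Rightarrow> 'o"
  Cod :: "'a \<Rightarrow> 'o"
  Ident :: "'o \<Rightarrow> 'a" ("\<iota>\<index>")
  Comp :: "'a \<Rightarrow> 'a \<Rightarrow> 'a" (infixr "\<cdot>\<index>" 65)

definition Hom :: "('o, 'a, 'm) cat_data_scheme \<Rightarrow> 'o \<Rightarrow> 'o \<Rightarrow> 'a set" where
  "Hom C X Y = {f \<in> Arr C. Dom C f = X \<and> Cod C f = Y}"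

definition inverse_arrows :: "('o, 'a, 'm) cat_data_scheme \<Rightarrow> 'a \<Rightarrow> 'a \<Rightarrow> bool" where
  "inverse_arrows C f g \<longleftrightarrow>
     f \<in> Hom C (Dom C f) (Cod C f) \<and> g \<in> Hom C (Cod C f) (Dom C f) \<and>
     Comp C g f = Ident C (Dom C f) \<and> Comp C f g = Ident C (Cod C f)"

definition is_iso :: "('o, 'a, 'm) cat_data_scheme \<Rightarrow> 'a \<Rightarrow> bool" where
  "is_iso C f \<longleftrightarrow> (\<exists>g. inverse_arrows C f g)"

text \<open>Meaningful only when \<open>f\<close> is an isomorphism of a category; the inverse is then unique.\<close>
definition inverse_arr :: "('o, 'a, 'm) cat_data_scheme \<Rightarrow> 'a \<Rightarrow> 'a" where
  "inverse_arr C f = (THE g. inverse_arrows C f g)"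

locale category =
  fixes C :: "('o, 'a, 'm) cat_data_scheme" (structure)
  assumes dom_in_Obj: "f \<in> Arr C \<Longrightarrow> Dom C f \<in> Obj C"
    and cod_in_Obj: "f \<in> Arr C \<Longrightarrow> Cod C f \<in> Obj C"
    and ident_in_Hom: "X \<in> Obj C \<Longrightarrow> \<iota> X \<in> Hom C X X"
    and comp_in_Hom: "f \<in> Hom C X Y \<Longrightarrow> g \<in> Hom C Y Z \<Longrightarrow> g \<cdot> f \<in> Hom C X Z"
    and comp_ident_right: "f \<in> Hom C X Y \<Longrightarrow> f \<cdot> \<iota> X = f"
    and comp_ident_left: "f \<in> Hom C X Y \<Longrightarrow> \<iota> Y \<cdot> f = f"
    and comp_assoc:
      "f \<in> Hom C W X \<Longrightarrow> g \<in> Hom C X Y \<Longrightarrow> h \<in> Hom C Y Z \<Longrightarrow> (h \<cdot> g) \<cdot> f = h \<cdot> (g \<cdot> f)"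
begin

lemma inverse_arr_eqI:
  assumes "inverse_arrows C f g"
  shows "inverse_arr C f = g"
  unfolding inverse_arr_def
proof (rule the_equality)
  show "inverse_arrows C f g" by (fact assms)
next
  fix h
  assume h: "inverse_arrows C f h"
  have "h = h \<cdot> (f \<cdot> g)"
    using assms h comp_ident_right unfolding inverse_arrows_def by metis
  also have "\<dots> = (h \<cdot> f) \<cdot> g"
    using assms h comp_assoc unfolding inverse_arrows_def by metis
  also have "\<dots> = g"
    using assms h comp_ident_left unfolding inverse_arrows_def by metis
  finally show "h = g" .
qed

end

record ('o, 'a) monoidal_data = "('o, 'a) cat_data" +
  Tensor_obj :: "'o \<Rightarrow> 'o \<Rightarrow> 'o" (infixl "\<otimes>\<index>" 75)
  Tensor_arr :: "'a \<Rightarrow> 'a \<Rightarrow> 'a" (infixl "\<boxtimes>\<index>" 75)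
  Unit :: "'o" ("\<I>\<index>")
  Associator :: "'o \<Rightarrow> 'o \<Rightarrow> 'o \<Rightarrow> 'a" ("\<alpha>\<index>")
  Left_unitor :: "'o \<Rightarrow> 'a" ("\<l>\<index>")
  Right_unitor :: "'o \<Rightarrow> 'a" ("\<rho>\<index>")

locale monoidal_category = category C
  for C :: "('o, 'a, 'm) monoidal_data_scheme" (structure) +
  assumes tensor_obj_in_Obj: "X \<in> Obj C \<Longrightarrow> Y \<in> Obj C \<Longrightarrow> X \<otimes> Y \<in> Obj C"
    and unit_in_Obj: "\<I> \<in> Obj C"
    and tensor_in_Hom:
      "f \<in> Hom C X X' \<Longrightarrow> g \<in> Hom C Y Y' \<Longrightarrow> f \<boxtimes> g \<in> Hom C (X \<otimes> Y) (X' \<otimes> Y')"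
    and tensor_ident: "X \<in> Obj C \<Longrightarrow> Y \<in> Obj C \<Longrightarrow> \<iota> X \<boxtimes> \<iota> Y = \<iota> (X \<otimes> Y)"
    and tensor_comp:
      "f \<in> Hom C X X' \<Longrightarrow> f' \<in> Hom C X' X'' \<Longrightarrow> g \<in> Hom C Y Y' \<Longrightarrow> g' \<in> Hom C Y' Y'' \<Longrightarrow>
        (f' \<cdot> f) \<boxtimes> (g' \<cdot> g) = (f' \<boxtimes> g') \<cdot> (f \<boxtimes> g)"
    and associator_in_Hom:
      "X \<in> Obj C \<Longrightarrow> Y \<in> Obj C \<Longrightarrow> Z \<in> Obj C \<Longrightarrow>
        \<alpha> X Y Z \<in> Hom C ((X \<otimes> Y) \<otimes> Z) (X \<otimes> (Y \<otimes> Z))"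
    and associator_iso:
      "X \<in> Obj C \<Longrightarrow> Y \<in> Obj C \<Longrightarrow> Z \<in> Obj C \<Longrightarrow> is_iso C (\<alpha> X Y Z)"
    and associator_natural:
      "f \<in> Hom C X X' \<Longrightarrow> g \<in> Hom C Y Y' \<Longrightarrow> h \<in> Hom C Z Z' \<Longrightarrow>
        \<alpha> X' Y' Z' \<cdot> ((f \<boxtimes> g) \<boxtimes> h) = (f \<boxtimes> (g \<boxtimes> h)) \<cdot> \<alpha> X Y Z"
    and left_unitor_in_Hom: "X \<in> Obj C \<Longrightarrow> \<l> X \<in> Hom C (\<I> \<otimes> X) X"
    and left_unitor_iso: "X \<in> Obj C \<Longrightarrow> is_iso C (\<l> X)"
    and left_unitor_natural: "f \<in> Hom C X Y \<Longrightarrow> \<l> Y \<cdot> (\<iota> \<I> \<boxtimes> f) = f \<cdot> \<l> X"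
    and right_unitor_in_Hom: "X \<in> Obj C \<Longrightarrow> \<rho> X \<in> Hom C (X \<otimes> \<I>) X"
    and right_unitor_iso: "X \<in> Obj C \<Longrightarrow> is_iso C (\<rho> X)"
    and right_unitor_natural: "f \<in> Hom C X Y \<Longrightarrow> \<rho> Y \<cdot> (f \<boxtimes> \<iota> \<I>) = f \<cdot> \<rho> X"
    and pentagon:
      "W \<in> Obj C \<Longrightarrow> X \<in> Obj C \<Longrightarrow> Y \<in> Obj C \<Longrightarrow> Z \<in> Obj C \<Longrightarrow>
        (\<iota> W \<boxtimes> \<alpha> X Y Z) \<cdot> \<alpha> W (X \<otimes> Y) Z \<cdot> (\<alpha> W X Y \<boxtimes> \<iota> Z) =
        \<alpha> W X (Y \<otimes> Z) \<cdot> \<alpha> (W \<otimes> X) Y Z"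
    and triangle:
      "X \<in> Obj C \<Longrightarrow> Y \<in> Obj C \<Longrightarrow> (\<iota> X \<boxtimes> \<l> Y) \<cdot> \<alpha> X \<I> Y = \<rho> X \<boxtimes> \<iota> Y"

record ('o, 'a) symmetric_monoidal_data = "('o, 'a) monoidal_data" +
  Braiding :: "'o \<Rightarrow> 'o \<Rightarrow> 'a" ("\<gamma>\<index>")

text \<open>
  The second hexagon and the compatibility of the braiding with the unitors follow from the
  axioms below. The braiding is invertible by \<open>braiding_symmetric\<close>.
\<close>
locale symmetric_monoidal_category = monoidal_category C
  for C :: "('o, 'a, 'm) symmetric_monoidal_data_scheme" (structure) +
  assumes braiding_in_Hom:
      "X \<in> Obj C \<Longrightarrow> Y \<in> Obj C \<Longrightarrow> \<gamma> X Y \<in> Hom C (X \<otimes> Y) (Y \<otimes> X)"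
    and braiding_natural:
      "f \<in> Hom C X X' \<Longrightarrow> g \<in> Hom C Y Y' \<Longrightarrow> \<gamma> X' Y' \<cdot> (f \<boxtimes> g) = (g \<boxtimes> f) \<cdot> \<gamma> X Y"
    and braiding_symmetric:
      "X \<in> Obj C \<Longrightarrow> Y \<in> Obj C \<Longrightarrow> \<gamma> Y X \<cdot> \<gamma> X Y = \<iota> (X \<otimes> Y)"
    and hexagon:
      "X \<in> Obj C \<Longrightarrow> Y \<in> Obj C \<Longrightarrow> Z \<in> Obj C \<Longrightarrow>
        \<alpha> Y Z X \<cdot> \<gamma> X (Y \<otimes> Z) \<cdot> \<alpha> X Y Z =
        (\<iota> Y \<boxtimes> \<gamma> X Z) \<cdot> \<alpha> Y X Z \<cdot> (\<gamma> X Y \<boxtimes> \<iota> Z)"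

text \<open>
  The arrow \<open>id \<otimes> \<gamma> \<otimes> id\<close> with its coherence isomorphisms, as the composite
  \<open>(X\<otimes>X)\<otimes>(Y\<otimes>Y) \<rightarrow> X\<otimes>(X\<otimes>(Y\<otimes>Y)) \<rightarrow> X\<otimes>((X\<otimes>Y)\<otimes>Y) \<rightarrow>
   X\<otimes>((Y\<otimes>X)\<otimes>Y) \<rightarrow> X\<otimes>(Y\<otimes>(X\<otimes>Y)) \<rightarrow> (X\<otimes>Y)\<otimes>(X\<otimes>Y)\<close>.
\<close>
definition middle_swap ::
    "('o, 'a, 'm) symmetric_monoidal_data_scheme \<Rightarrow> 'o \<Rightarrow> 'o \<Rightarrow> 'a" ("\<sigma>\<index>") where
  "middle_swap C X Y =
     inverse_arr C (\<alpha>\<^bsub>C\<^esub> X Y (X \<otimes>\<^bsub>C\<^esub> Y)) \<cdot>\<^bsub>C\<^esub>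
     (\<iota>\<^bsub>C\<^esub> X \<boxtimes>\<^bsub>C\<^esub> \<alpha>\<^bsub>C\<^esub> Y X Y) \<cdot>\<^bsub>C\<^esub>
     (\<iota>\<^bsub>C\<^esub> X \<boxtimes>\<^bsub>C\<^esub> (\<gamma>\<^bsub>C\<^esub> X Y \<boxtimes>\<^bsub>C\<^esub> \<iota>\<^bsub>C\<^esub> Y)) \<cdot>\<^bsub>C\<^esub>
     (\<iota>\<^bsub>C\<^esub> X \<boxtimes>\<^bsub>C\<^esub> inverse_arr C (\<alpha>\<^bsub>C\<^esub> X Y Y)) \<cdot>\<^bsub>C\<^esub>
     \<alpha>\<^bsub>C\<^esub> X X (Y \<otimes>\<^bsub>C\<^esub> Y)"

record ('o, 'a) gs_monoidal_data = "('o, 'a) symmetric_monoidal_data" +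
  Duplicator :: "'o \<Rightarrow> 'a" ("\<nabla>\<index>")
  Discharger :: "'o \<Rightarrow> 'a" ("\<epsilon>\<index>")

text \<open>
  \<open>\<epsilon> X\<close> is the discharger, informally written \<open>!\<close>. Neither \<open>\<nabla>\<close> nor \<open>\<epsilon>\<close> is assumed natural.
\<close>
locale gs_monoidal_category = symmetric_monoidal_category C
  for C :: "('o, 'a, 'm) gs_monoidal_data_scheme" (structure) +
  assumes duplicator_in_Hom: "X \<in> Obj C \<Longrightarrow> \<nabla> X \<in> Hom C X (X \<otimes> X)"
    and discharger_in_Hom: "X \<in> Obj C \<Longrightarrow> \<epsilon> X \<in> Hom C X \<I>"
    and duplicator_coassociative:
      "X \<in> Obj C \<Longrightarrow> \<alpha> X X X \<cdot> (\<nabla> X \<boxtimes> \<iota> X) \<cdot> \<nabla> X = (\<iota> X \<boxtimes> \<nabla> X) \<cdot> \<nabla> X"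
    and duplicator_cocommutative: "X \<in> Obj C \<Longrightarrow> \<gamma> X X \<cdot> \<nabla> X = \<nabla> X"
    and duplicator_counit_left: "X \<in> Obj C \<Longrightarrow> \<l> X \<cdot> (\<epsilon> X \<boxtimes> \<iota> X) \<cdot> \<nabla> X = \<iota> X"
    and duplicator_counit_right: "X \<in> Obj C \<Longrightarrow> \<rho> X \<cdot> (\<iota> X \<boxtimes> \<epsilon> X) \<cdot> \<nabla> X = \<iota> X"
    and duplicator_tensor:
      "X \<in> Obj C \<Longrightarrow> Y \<in> Obj C \<Longrightarrow> \<nabla> (X \<otimes> Y) = \<sigma> X Y \<cdot> (\<nabla> X \<boxtimes> \<nabla> Y)"
    and duplicator_unit: "\<nabla> \<I> = inverse_arr C (\<l> \<I>)"
    and discharger_tensor: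
      "X \<in> Obj C \<Longrightarrow> Y \<in> Obj C \<Longrightarrow> \<epsilon> (X \<otimes> Y) = \<l> \<I> \<cdot> (\<epsilon> X \<boxtimes> \<epsilon> Y)"
    and discharger_unit: "\<epsilon> \<I> = \<iota> \<I>"

definition has_projections :: "('o, 'a, 'm) gs_monoidal_data_scheme \<Rightarrow> bool" where
  "has_projections C \<longleftrightarrow>
     (\<forall>X \<in> Obj C. \<forall>Y \<in> Obj C. \<forall>f \<in> Hom C X Y. \<epsilon>\<^bsub>C\<^esub> Y \<cdot>\<^bsub>C\<^esub> f = \<epsilon>\<^bsub>C\<^esub> X)"

locale markov_category = gs_monoidal_category C
  for C :: "('o, 'a, 'm) gs_monoidal_data_scheme" (structure) +
  assumes arrow_to_unit_eq_discharger: "X \<in> Obj C \<Longrightarrow> f \<in> Hom C X \<I> \<Longrightarrow> f = \<epsilon> X"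

end

theory Submission
  imports Defs
begin

text \<open>
  An arrow \<open>f\<close> into the unit satisfies \<open>f = \<iota> \<I> \<cdot> f = \<epsilon> \<I> \<cdot> f\<close>, because the discharger of the unit is
  the identity. Naturality of the dischargers at \<open>f\<close> therefore says that \<open>f\<close> is the discharger of
  its domain. Conversely, in a Markov category \<open>\<epsilon> Y \<cdot> f\<close> is itself an arrow from \<open>X\<close> to the unit, so
  it can only be \<open>\<epsilon> X\<close>. Both conditions thus say that the unit is terminal.
\<close>

lemma (in gs_monoidal_category) projections_imp_unit_terminal:
  assumes "has_projections C" and X: "X \<in> Obj C" and f: "f \<in> Hom C X \<I>"
  shows "f = \<epsilon> X"
proof -
  have "f = \<iota> \<I> \<cdot> f"
    using comp_ident_left[OF f] by simp
  also have "\<dots> = \<epsilon> \<I> \<cdot> f"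
    by (simp only: discharger_unit)
  also have "\<dots> = \<epsilon> X"
    using assms unit_in_Obj unfolding has_projections_def by blast
  finally show ?thesis .
qed

lemma (in markov_category) markov_has_projections: "has_projections C"
  unfolding has_projections_def
proof (intro ballI)
  fix X Y f
  assume X: "X \<in> Obj C" and Y: "Y \<in> Obj C" and f: "f \<in> Hom C X Y"
  have "\<epsilon> Y \<cdot> f \<in> Hom C X \<I>"
    using f discharger_in_Hom[OF Y] by (rule comp_in_Hom)
  with X show "\<epsilon> Y \<cdot> f = \<epsilon> X"
    by (rule arrow_to_unit_eq_discharger)
qed

theorem proposition2p56:
  fixes C :: "('o, 'a, 'm) gs_monoidal_data_scheme"
  assumes "gs_monoidal_category C"
  shows "has_projections C \<longleftrightarrow> markov_category C"
proof
  assume "has_projections C"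
  with assms show "markov_category C"
    by (intro markov_category.intro markov_category_axioms.intro
        gs_monoidal_category.projections_imp_unit_terminal)
next
  assume "markov_category C"
  then show "has_projections C"
    by (rule markov_category.markov_has_projections)
qed

end
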